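(* Let $(B,+,\circ)$ be a compact skew left brace. Then the following statements are equivalent: (1) $\mathrm{Pb}(B)>0$. (2) $\mathrm{FCI}(B)$ is open in $B$. (3) $[(B,\circ):\mathrm{FCI}(B)]<\infty$.
   Context: A skew left brace is a set $B$ with two group structures $(B,+)$ and $(B,\circ)$ (neither assumed abelian) such that $a\circ(b+c)=(a\circ b)-a+(a\circ c)$ for all $a,b,c\in B$, where $-a$ is the inverse of $a$ in $(B,+)$. The identities of the two groups coincide and are denoted by $1$. A topological skew left brace is a skew left brace equipped with one topology for which both $(B,+)$ and $(B,\circ)$ are topological groups. "Compact skew left brace" means a topological skew left brace whose topology is compact and Hausdorff. Put $a*b:=-a+(a\circ b)-b$ and $[a,b]^+:=a+b-a-b$. The brace centralizer of $x\in B$ is $\mathrm{Cb}_B(x):=\{b\in B\mid x*b=b*x=[x,b]^+=1\}$; it is a closed subgroup of $(B,\circ)$. $\mathrm{FCI}(B)$ is the set of all $x\in B$ such that the index $[(B,\circ):\mathrm{Cb}_B(x)]$ is finite; it is a subgroup of $(B,\circ)$. Let $\mu$ be the unique probability Haar measure on $(B,+)$ (it is also the probability Haar measure on $(B,\circ)$), and let $Z:=\{(a,b)\in B\times B\mid a*b=b*a=[a,b]^+=1\}$, a closed subset of $B\times B$. The commuting probability is $\mathrm{Pb}(B):=(\mu\times\mu)(Z)$. *)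

theory Defs
  imports "HOL-Probability.Probability" "HOL-Algebra.Coset"
begin

text \<open>
  The additive group of the brace is the ambient type of class \<open>group_add\<close> (not assumed
  abelian); the multiplicative group is an \<open>HOL-Algebra\<close> group \<open>B\<close> with carrier the whole
  type, so that \<open>x \<otimes>\<^bsub>B\<^esub> y\<close> is \<open>x \<circ> y\<close>.  The common identity is \<open>0\<close>, see
  \<open>one_eq_zero\<close> below.
\<close>

locale skew_left_brace = group B for B :: "'a::group_add monoid" (structure) +
  assumes carrier_UNIV: "carrier B = UNIV"
    and brace_law: "a \<otimes> (b + c) = (a \<otimes> b) - a + (a \<otimes> c)"
begin

lemma one_eq_zero: "\<one> = 0"
proof -
  have "\<one> \<otimes> 0 = 0"
    by (simp add: carrier_UNIV)
  moreover have "\<one> \<otimes> (0 + 0) = (\<one> \<otimes> 0) - \<one> + (\<one> \<otimes> 0)"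
    by (rule brace_law)
  ultimately show ?thesis
    by simp
qed

end

locale compact_skew_left_brace = skew_left_brace B
  for B :: "'a::{topological_group_add, t2_space} monoid" (structure) +
  assumes continuous_mult: "continuous_on UNIV (\<lambda>(a, b). a \<otimes> b)"
    and continuous_inv: "continuous_on UNIV (\<lambda>a. inv a)"
    and compact_UNIV: "compact (UNIV :: 'a set)"

definition star :: "'a::group_add monoid \<Rightarrow> 'a \<Rightarrow> 'a \<Rightarrow> 'a" where
  "star B a b = - a + (a \<otimes>\<^bsub>B\<^esub> b) - b"

definition add_commutator :: "'a::group_add \<Rightarrow> 'a \<Rightarrow> 'a" where
  "add_commutator a b = a + b - a - b"

definition Cb :: "'a::group_add monoid \<Rightarrow> 'a \<Rightarrow> 'a set" where
  "Cb B x = {b. star B x b = 0 \<and> star B b x = 0 \<and> add_commutator x b = 0}"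

definition FCI :: "'a::group_add monoid \<Rightarrow> 'a set" where
  "FCI B = {x. finite (rcosets\<^bsub>B\<^esub> (Cb B x))}"

definition commuting_pairs :: "'a::group_add monoid \<Rightarrow> ('a \<times> 'a) set" where
  "commuting_pairs B = {(a, b). star B a b = 0 \<and> star B b a = 0 \<and> add_commutator a b = 0}"

text \<open>
  Borel probability measures inner regular with respect to compact sets; used on compact
  Hausdorff spaces only, where compact sets are Borel and outer regularity by open sets follows.
\<close>

definition radon_prob :: "'a::topological_space measure \<Rightarrow> bool" where
  "radon_prob M \<longleftrightarrow> prob_space M \<and> sets M = sets borel \<and>
     (\<forall>A\<in>sets borel. emeasure M A = (SUP K\<in>{K. compact K \<and> K \<subseteq> A}. emeasure M K))"

definition haar_prob :: "'a::topological_group_add measure \<Rightarrow> bool" where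
  "haar_prob M \<longleftrightarrow> radon_prob M \<and>
     (\<forall>a. \<forall>A\<in>sets borel. emeasure M ((\<lambda>x. a + x) ` A) = emeasure M A)"

text \<open>
  The product of two Radon probability measures as a Radon measure on the Borel sets of the
  product space; it is determined uniquely by its values on rectangles.  For spaces that are not
  second countable, the sigma-algebra of the library product \<open>M \<Otimes>\<^sub>M N\<close> can be strictly smaller
  than the Borel sigma-algebra: it need not contain every closed set, and \<open>emeasure\<close> is \<open>0\<close> on
  the sets it does not contain.
\<close>

definition is_radon_product ::
    "'a::topological_space measure \<Rightarrow> 'b::topological_space measure \<Rightarrow> ('a \<times> 'b) measure \<Rightarrow> bool"
  where
  "is_radon_product M N P \<longleftrightarrow> radon_prob P \<and>
     (\<forall>A\<in>sets borel. \<forall>C\<in>sets borel. emeasure P (A \<times> C) = emeasure M A * emeasure N C)"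

text \<open>The argument \<open>P\<close> stands for the product of the Haar measure with itself.\<close>

definition Pb :: "'a::{group_add, topological_space} monoid \<Rightarrow> ('a \<times> 'a) measure \<Rightarrow> real" where
  "Pb B P = measure P (commuting_pairs B)"

end

theory Submission
  imports Defs
begin

text \<open>
  The three conditions are linked by a fourth one: for some \<open>t > 0\<close>, the closed set
  \<open>thick t\<close> of all \<open>x\<close> whose brace centralizer has Haar measure at least \<open>t\<close> has positive
  measure.

  The set of commuting pairs is closed, and its section at \<open>x\<close> is the centralizer of \<open>x\<close>.
  By Fubini, its measure is positive if and only if a set of positive measure of points has
  sections whose measure is bounded away from \<open>0\<close>; this is the equivalence of positive commuting
  probability with the fourth condition (\<open>radon_product_positive_iff\<close>).

  The rest takes place in the multiplicative group.  Left multiplication by \<open>a\<close> is an additive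
  automorphism followed by an additive translation, so by uniqueness of Haar measure
  (\<open>haar_prob_unique\<close>) the additive Haar measure is also invariant under it.  In a compact
  group with invariant measure, a subgroup that contains a closed set of positive measure is open
  (\<open>open_subgroup_if_positive_measure\<close>), an open subgroup has finite index
  (\<open>finite_index_if_open\<close>), and if a subgroup of finite index is covered by countably many
  Borel sets, then one of these has positive measure (\<open>positive_measure_if_finite_index\<close>).

  This cycle is used twice.  For the centralizers, which are closed subgroups, it shows that finite
  index, openness and positive measure are the same.  Hence \<open>FCI B\<close> is a subgroup and is
  the union of the sets \<open>thick t\<close> over \<open>t = 1, 1/2, 1/3, \<dots>\<close>.  For \<open>FCI B\<close> itself, it says that
  the fourth condition implies that \<open>FCI B\<close> is open, that this implies finite index, and that
  finite index implies the fourth condition.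
\<close>

section \<open>Radon probability measures\<close>

lemma radon_prob_prob_space: "radon_prob M \<Longrightarrow> prob_space M"
  and radon_prob_sets: "radon_prob M \<Longrightarrow> sets M = sets borel"
  by (simp_all add: radon_prob_def)

lemma radon_prob_space: "radon_prob M \<Longrightarrow> space M = UNIV"
  using sets_eq_imp_space_eq[OF radon_prob_sets] by simp

lemma radon_prob_measurable:
  assumes "radon_prob M" "continuous_on UNIV f"
  shows "f \<in> borel_measurable M"
  using borel_measurable_continuous_onI[OF assms(2)]
  by (simp cong: measurable_cong_sets add: radon_prob_sets[OF assms(1)])

lemma radon_prob_inner:
  assumes M: "radon_prob M" and A: "A \<in> sets borel" and t: "t < measure M A"
  obtains K where "compact K" "K \<subseteq> A" "t < measure M K"
proof (cases "t < 0")
  case True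
  then show ?thesis
    by (intro that[of "{}"]) auto
next
  case False
  interpret prob_space M
    using M by (rule radon_prob_prob_space)
  have "ennreal t < emeasure M A"
    using t False by (simp add: emeasure_eq_measure ennreal_less_iff)
  also have "\<dots> = (SUP K\<in>{K. compact K \<and> K \<subseteq> A}. emeasure M K)"
    using M A by (simp add: radon_prob_def)
  finally obtain K where "compact K" "K \<subseteq> A" "ennreal t < emeasure M K"
    by (auto simp: less_SUP_iff)
  then show ?thesis
    using False by (intro that[of K]) (auto simp: emeasure_eq_measure ennreal_less_iff)
qed

text \<open>
  The complement of a compact set that fills most of \<open>- A\<close> is open in a Hausdorff space.
\<close>

lemma radon_prob_outer:
  fixes M :: "'a::t2_space measure"
  assumes M: "radon_prob M" and A: "A \<in> sets borel" and t: "measure M A < t"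
  obtains V where "open V" "A \<subseteq> V" "measure M V < t"
proof -
  interpret prob_space M
    using M by (rule radon_prob_prob_space)
  note [simp] = radon_prob_sets[OF M] radon_prob_space[OF M]
  have compl: "measure M (- X) = 1 - measure M X" if "X \<in> sets borel" for X
    using prob_compl[of X] that by (simp add: Compl_eq_Diff_UNIV)
  have "1 - t < measure M (- A)"
    using t A by (simp add: compl)
  then obtain K where K: "compact K" "K \<subseteq> - A" "1 - t < measure M K"
    using radon_prob_inner[OF M, of "- A"] A by auto
  then have "closed K"
    by (simp add: compact_imp_closed)
  then show ?thesis
    using K by (intro that[of "- K"]) (auto simp: compl)
qed

lemma radon_prob_distr_homeomorphism:
  fixes f :: "'a::t2_space \<Rightarrow> 'b::t2_space"
  assumes M: "radon_prob M"
    and f: "continuous_on UNIV f" and g: "continuous_on UNIV g"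
    and gf: "\<And>x. g (f x) = x" and fg: "\<And>y. f (g y) = y"
  shows "radon_prob (distr M borel f)"
proof -
  note [simp] = radon_prob_sets[OF M] radon_prob_space[OF M]
  have [measurable]: "f \<in> measurable M borel"
    using M f by (rule radon_prob_measurable)
  have em: "emeasure (distr M borel f) A = emeasure M (f -` A)" if "A \<in> sets borel" for A
    using that by (simp add: emeasure_distr)
  have vim: "f -` A \<in> sets borel" if "A \<in> sets borel" for A
    using that measurable_sets[OF borel_measurable_continuous_onI[OF f], of A] by simp
  have cpt: "{K. compact K \<and> K \<subseteq> f -` A} = (\<lambda>K. f -` K) ` {K. compact K \<and> K \<subseteq> A}" for A
  proof (intro equalityI subsetI)
    fix K assume "K \<in> {K. compact K \<and> K \<subseteq> f -` A}"
    moreover have "K = f -` (f ` K)"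
      using gf by (metis inj_on_inverseI inj_vimage_image_eq)
    ultimately show "K \<in> (\<lambda>K. f -` K) ` {K. compact K \<and> K \<subseteq> A}"
      using compact_continuous_image[OF continuous_on_subset[OF f subset_UNIV], of K]
      by (intro image_eqI[of _ _ "f ` K"]) auto
  next
    fix L assume "L \<in> (\<lambda>K. f -` K) ` {K. compact K \<and> K \<subseteq> A}"
    then obtain K where K: "compact K" "K \<subseteq> A" "L = f -` K"
      by auto
    have "L = g ` K"
      unfolding K(3) by (auto simp: fg gf intro!: image_eqI[of _ g "f _"])
    then show "L \<in> {K. compact K \<and> K \<subseteq> f -` A}"
      using K compact_continuous_image[OF continuous_on_subset[OF g subset_UNIV], of K] by auto
  qed
  have "prob_space (distr M borel f)"
    using M by (intro prob_space.prob_space_distr radon_prob_prob_space) simp_all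
  moreover have "emeasure (distr M borel f) A =
      (SUP K\<in>{K. compact K \<and> K \<subseteq> A}. emeasure (distr M borel f) K)"
    if A: "A \<in> sets borel" for A
  proof -
    have "emeasure (distr M borel f) A = emeasure M (f -` A)"
      using A by (rule em)
    also have "\<dots> = (SUP K\<in>{K. compact K \<and> K \<subseteq> f -` A}. emeasure M K)"
      using M vim[OF A] by (simp add: radon_prob_def)
    also have "\<dots> = (SUP K\<in>{K. compact K \<and> K \<subseteq> A}. emeasure M (f -` K))"
      unfolding cpt by (simp add: image_comp comp_def)
    also have "\<dots> = (SUP K\<in>{K. compact K \<and> K \<subseteq> A}. emeasure (distr M borel f) K)"
      by (intro SUP_cong) (auto simp: em compact_imp_closed)
    finally show ?thesis .
  qed
  ultimately show ?thesis
    by (simp add: radon_prob_def)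
qed

lemma borel_vimage_continuous:
  assumes "continuous_on UNIV f" "A \<in> sets borel"
  shows "f -` A \<in> sets borel"
  using measurable_sets[OF borel_measurable_continuous_onI[OF assms(1)] assms(2)] by simp

text \<open>
  The tube lemma.  It makes all the sets open along which the finite covers below are taken.
\<close>

lemma open_tube:
  assumes "compact C" "open W"
  shows "open {x. \<forall>y\<in>C. (x, y) \<in> W}"
proof (subst open_subopen, clarify)
  fix x assume "\<forall>y\<in>C. (x, y) \<in> W"
  then have "{x} \<times> C \<subseteq> W"
    by auto
  from Elementary_Topology.tube_lemma[OF assms this]
  obtain X0 where "x \<in> X0" "open X0" "X0 \<times> C \<subseteq> W"
    by auto
  then show "\<exists>T. open T \<and> x \<in> T \<and> T \<subseteq> {x. \<forall>y\<in>C. (x, y) \<in> W}"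
    by (intro exI[of _ X0]) auto
qed

text \<open>
  This replaces integration over \<open>K\<close>.  A property that every point \<open>x\<close> shares with a
  neighbourhood \<open>U x\<close> can be made constant on the pieces of a finite Borel partition, so that
  integrals of the functions of interest become finite sums.  The rectangles over the pieces stay
  within reach of \<open>is_radon_product\<close>, also where the Borel sets of the product are more than the
  product \<open>\<sigma>\<close>-algebra.
\<close>

lemma compact_disjoint_partition:
  fixes K :: "'a::t2_space set"
  assumes K: "compact K" and U: "\<And>x. x \<in> K \<Longrightarrow> open (U x)" "\<And>x. x \<in> K \<Longrightarrow> x \<in> U x"
  obtains F D where "finite F" "F \<subseteq> K" "disjoint_family_on D F"
    "\<And>x. x \<in> F \<Longrightarrow> D x \<in> sets borel" "\<And>x. x \<in> F \<Longrightarrow> D x \<subseteq> U x" "(\<Union>x\<in>F. D x) = K"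
proof -
  obtain F where F: "F \<subseteq> K" "finite F" "K \<subseteq> (\<Union>x\<in>F. U x)"
    using compactE_image[of K K U] K U by blast
  obtain n and e :: "nat \<Rightarrow> 'a" where e: "F = e ` {i. i < n}" "inj_on e {i. i < n}"
    using finite_imp_nat_seg_image_inj_on[OF F(2)] by metis
  define D where "D x = K \<inter> disjointed (U \<circ> e) (inv_into {i. i < n} e x)" for x
  have De: "D (e i) = K \<inter> disjointed (U \<circ> e) i" if "i < n" for i
    using that e by (simp add: D_def)
  have UN: "(\<Union>i<n. disjointed (U \<circ> e) i) = (\<Union>i<n. U (e i))"
    using finite_UN_disjointed_eq[of "U \<circ> e" n] by (simp add: lessThan_atLeast0)
  show ?thesis
  proof (rule that[of F D])
    show "disjoint_family_on D F"
      unfolding disjoint_family_on_def e(1)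
    proof clarify
      fix i j assume ij: "i < n" "j < n" "e i \<noteq> e j"
      then have "i \<noteq> j"
        by blast
      then have "disjointed (U \<circ> e) i \<inter> disjointed (U \<circ> e) j = {}"
        using disjoint_family_disjointed[of "U \<circ> e"] by (simp add: disjoint_family_on_def)
      then show "D (e i) \<inter> D (e j) = {}"
        using ij De by auto
    qed
    show "D x \<in> sets borel" if "x \<in> F" for x
    proof -
      obtain i where i: "i < n" "x = e i"
        using \<open>x \<in> F\<close> e(1) by auto
      have "U (e j) \<in> sets borel" if "j < n" for j
        using that e(1) F(1) U(1) by (intro borel_open) auto
      then have "disjointed (U \<circ> e) i \<in> sets borel"
        unfolding disjointed_def using i by (intro sets.Diff sets.finite_UN) simp_all
      then show ?thesis
        using i De K by (simp add: compact_imp_closed)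
    qed
    show "D x \<subseteq> U x" if "x \<in> F" for x
      using that e De disjointed_subset[of "U \<circ> e"] by fastforce
    have "(\<Union>x\<in>F. D x) = K \<inter> (\<Union>i<n. disjointed (U \<circ> e) i)"
      using e(1) De by auto
    also have "\<dots> = K"
      unfolding UN using F(3) e(1) by auto
    finally show "(\<Union>x\<in>F. D x) = K" .
  qed (use F in auto)
qed

section \<open>Uniqueness of Haar measure\<close>

text \<open>
  A Fubini argument for the set of pairs \<open>(x, y)\<close> with \<open>x + y \<in> U\<close>: its sections in the
  direction of \<open>y\<close> all have \<open>N\<close>-measure \<open>measure N U\<close>, and its sections in the direction of
  \<open>x\<close> all have \<open>M\<close>-measure \<open>measure M U\<close>.  The set is approximated from inside by a finite
  union of disjoint rectangles \<open>D x \<times> T x\<close>, where \<open>T x\<close> is the \<open>x\<close>-section that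
  belongs to a compact subset \<open>C\<close> of \<open>U\<close>; summing over the rectangles in both orders gives
  the inequality.
\<close>

lemma left_invariant_le_right_invariant:
  fixes M N :: "'a::{topological_group_add, t2_space} measure"
  assumes cpt: "compact (UNIV :: 'a set)"
    and M: "radon_prob M" and N: "radon_prob N"
    and right: "\<And>a A. A \<in> sets borel \<Longrightarrow> measure M ((\<lambda>x. x + a) -` A) = measure M A"
    and left: "\<And>a A. A \<in> sets borel \<Longrightarrow> measure N ((\<lambda>x. a + x) -` A) = measure N A"
    and U: "open U"
  shows "measure N U \<le> measure M U"
proof (rule field_le_epsilon)
  interpret M: prob_space M
    using M by (rule radon_prob_prob_space)
  interpret N: prob_space N
    using N by (rule radon_prob_prob_space)
  note [simp] = radon_prob_sets[OF M] radon_prob_space[OF M]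
    radon_prob_sets[OF N] radon_prob_space[OF N]
  have cont_l: "continuous_on UNIV (\<lambda>x. a + x)" and cont_r: "continuous_on UNIV (\<lambda>x. x + a)"
    for a :: 'a
    by (intro continuous_intros)+
  fix e :: real assume "e > 0"
  then have "measure N U - e < measure N U"
    by simp
  then obtain C where C: "compact C" "C \<subseteq> U" "measure N U - e < measure N C"
    using radon_prob_inner[OF N borel_open[OF U]] by blast
  define T where "T x = (\<lambda>y. x + y) -` C" for x
  have "T x = (\<lambda>y. - x + y) ` C" for x
    unfolding T_def
    by (auto simp: image_iff add.assoc[symmetric] intro!: bexI[of _ "x + _"])
  then have T_compact: "compact (T x)" for x
    using C(1) by (simp add: compact_continuous_image continuous_on_subset[OF cont_l])
  then have T_borel[simp]: "T x \<in> sets borel" for x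
    by (simp add: compact_imp_closed)
  define G where "G x = {x'. \<forall>y\<in>T x. x' + y \<in> U}" for x
  have "open ((\<lambda>(x', y). x' + y) -` U)"
    using U by (intro open_vimage) (auto simp: case_prod_unfold intro!: continuous_intros)
  then have G_open: "open (G x)" for x
    using open_tube[OF T_compact[of x], of "(\<lambda>(x', y). x' + y) -` U"] by (simp add: G_def)
  have G_self: "x \<in> G x" for x
    using C(2) by (auto simp: G_def T_def)
  obtain F D where FD: "finite F" "disjoint_family_on D F" "\<And>x. x \<in> F \<Longrightarrow> D x \<in> sets borel"
      "\<And>x. x \<in> F \<Longrightarrow> D x \<subseteq> G x" "(\<Union>x\<in>F. D x) = (UNIV :: 'a set)"
    using compact_disjoint_partition[OF cpt, of G] G_open G_self by metis
  have sum1: "(\<Sum>x\<in>F. measure M (D x)) = 1"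
  proof -
    have "(\<Sum>x\<in>F. measure M (D x)) = measure M (\<Union>x\<in>F. D x)"
      using FD by (intro M.finite_measure_finite_Union[symmetric]) auto
    then show ?thesis
      using M.prob_space FD(5) by simp
  qed
  \<comment> \<open>The rectangles over \<open>y\<close> have disjoint bases, all inside the section of the set of
    pairs at \<open>y\<close>.\<close>
  have fibre: "(\<Sum>x\<in>F. measure M (D x) * indicator (T x) y) \<le> measure M U" for y
  proof -
    have "(\<Sum>x\<in>F. measure M (D x) * indicator (T x) y) = (\<Sum>x\<in>{x\<in>F. y \<in> T x}. measure M (D x))"
      using FD(1) by (simp add: indicator_def sum.If_cases Int_def if_distrib cong: if_cong)
    also have "\<dots> = measure M (\<Union>x\<in>{x\<in>F. y \<in> T x}. D x)"
      using FD by (intro M.finite_measure_finite_Union[symmetric])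
        (auto intro: disjoint_family_on_mono[of _ F])
    also have "\<dots> \<le> measure M ((\<lambda>x. x + y) -` U)"
      using FD(4) U by (intro M.finite_measure_mono)
        (auto simp: G_def intro!: borel_vimage_continuous cont_r)
    also have "\<dots> = measure M U"
      using U by (intro right) auto
    finally show ?thesis .
  qed
  have "measure N C = (\<Sum>x\<in>F. measure M (D x) * measure N (T x))"
    using sum1 left[of C] C(1) by (simp add: T_def sum_distrib_right[symmetric] compact_imp_closed)
  also have "\<dots> = (\<integral>y. (\<Sum>x\<in>F. measure M (D x) * indicator (T x) y) \<partial>N)"
    by (subst Bochner_Integration.integral_sum) (auto simp: N.emeasure_eq_measure)
  also have "\<dots> \<le> (\<integral>y. measure M U \<partial>N)"
    using fibre by (intro integral_mono) (auto intro!: Bochner_Integration.integrable_sum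
      simp: N.emeasure_eq_measure)
  also have "\<dots> = measure M U"
    using N.prob_space by simp
  finally show "measure N U \<le> measure M U + e"
    using C(3) by simp
qed

text \<open>
  Outer regularity extends the inequality to all Borel sets; for probability measures,
  passing to complements reverses it.
\<close>

lemma radon_prob_eqI_open_le:
  fixes M N :: "'a::t2_space measure"
  assumes M: "radon_prob M" and N: "radon_prob N"
    and le: "\<And>U. open U \<Longrightarrow> measure N U \<le> measure M U"
  shows "N = M"
proof (rule measure_eqI)
  interpret M: prob_space M
    using M by (rule radon_prob_prob_space)
  interpret N: prob_space N
    using N by (rule radon_prob_prob_space)
  note [simp] = radon_prob_sets[OF M] radon_prob_space[OF M]
    radon_prob_sets[OF N] radon_prob_space[OF N]
  show "sets N = sets M"
    by simp
  have le': "measure N A \<le> measure M A" if A: "A \<in> sets borel" for A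
  proof (rule field_le_epsilon)
    fix e :: real assume "e > 0"
    then have "measure M A < measure M A + e"
      by simp
    then obtain V where V: "open V" "A \<subseteq> V" "measure M V < measure M A + e"
      using radon_prob_outer[OF M A] by blast
    have "measure N A \<le> measure N V"
      using V by (intro N.finite_measure_mono) auto
    with V le[of V] show "measure N A \<le> measure M A + e"
      by linarith
  qed
  fix A assume "A \<in> sets N"
  then have A: "A \<in> sets borel"
    by simp
  have "measure N (- A) = 1 - measure N A" "measure M (- A) = 1 - measure M A"
    using A N.prob_compl[of A] M.prob_compl[of A] by (simp_all add: Compl_eq_Diff_UNIV)
  then have "measure N A = measure M A"
    using le'[OF A] le'[of "- A"] A by auto
  then show "emeasure N A = emeasure M A"
    by (simp add: M.emeasure_eq_measure N.emeasure_eq_measure)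
qed

lemma add_vimage_eq_image:
  fixes a :: "'a::group_add"
  shows "(\<lambda>x. a + x) -` A = (\<lambda>x. - a + x) ` A"
  by (auto simp: image_iff add.assoc[symmetric] intro!: bexI[of _ "a + _"])

lemma haar_prob_vimage:
  assumes "haar_prob M" "A \<in> sets borel"
  shows "emeasure M ((\<lambda>x. a + x) -` A) = emeasure M A"
  using assms by (simp add: haar_prob_def add_vimage_eq_image)

text \<open>
  The image of a left-invariant measure under \<open>x \<mapsto> - x\<close> is right-invariant.  So both \<open>M\<close>
  and \<open>N\<close> equal the reflection of \<open>M\<close>.
\<close>

theorem haar_prob_unique:
  fixes M N :: "'a::{topological_group_add, t2_space} measure"
  assumes cpt: "compact (UNIV :: 'a set)" and M: "haar_prob M" and N: "haar_prob N"
  shows "M = N"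
proof -
  have *: "L = distr M borel uminus" if L: "haar_prob L" for L
  proof (rule radon_prob_eqI_open_le)
    have RM: "radon_prob M" and RL: "radon_prob L"
      using M L by (simp_all add: haar_prob_def)
    note [simp] = radon_prob_sets[OF RM] radon_prob_space[OF RM]
    have cont: "continuous_on UNIV (uminus :: 'a \<Rightarrow> 'a)"
      by (intro continuous_intros)
    then have [measurable]: "uminus \<in> measurable M (borel :: 'a measure)"
      using RM by (rule radon_prob_measurable[rotated])
    show R: "radon_prob (distr M borel uminus)"
      using RM cont by (rule radon_prob_distr_homeomorphism[where g = uminus]) (auto intro: cont)
    show "radon_prob L"
      by fact
    have m: "measure (distr M borel uminus) A = measure M (uminus -` A)"
      if "A \<in> sets borel" for A :: "'a set"
      using that by (simp add: measure_distr)
    show "measure L U \<le> measure (distr M borel uminus) U" if U: "open U" for U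
    proof (rule left_invariant_le_right_invariant[OF cpt R RL _ _ U])
      fix a :: 'a and A :: "'a set" assume A: "A \<in> sets borel"
      have "(\<lambda>x. x + a) -` A \<in> sets borel"
        using A by (intro borel_vimage_continuous) (auto intro!: continuous_intros)
      then have "measure (distr M borel uminus) ((\<lambda>x. x + a) -` A)
          = measure M (uminus -` (\<lambda>x. x + a) -` A)"
        by (rule m)
      also have "uminus -` (\<lambda>x. x + a) -` A = (\<lambda>x. - a + x) -` (uminus -` A)"
        by (auto simp: minus_add)
      also have "measure M \<dots> = measure M (uminus -` A)"
        using haar_prob_vimage[OF M, of "uminus -` A"] A cont
        by (simp add: measure_def borel_vimage_continuous)
      finally show "measure (distr M borel uminus) ((\<lambda>x. x + a) -` A) =
          measure (distr M borel uminus) A"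
        using A by (simp add: m)
      show "measure L ((\<lambda>x. a + x) -` A) = measure L A"
        using haar_prob_vimage[OF L A] by (simp add: measure_def)
    qed
  qed
  show ?thesis
    using *[OF M] *[OF N] by simp
qed

section \<open>Products of Radon measures\<close>

lemma is_radon_product_finite_Union:
  fixes M :: "'a::t2_space measure" and N :: "'b::t2_space measure"
  assumes M: "radon_prob M" and N: "radon_prob N" and P: "is_radon_product M N P"
    and F: "finite F" "disjoint_family_on D F"
    and D: "\<And>x. x \<in> F \<Longrightarrow> D x \<in> sets borel" and C: "\<And>x. x \<in> F \<Longrightarrow> C x \<in> sets borel"
  shows "(\<Union>x\<in>F. D x \<times> C x) \<in> sets borel"
    and "measure P (\<Union>x\<in>F. D x \<times> C x) = (\<Sum>x\<in>F. measure M (D x) * measure N (C x))"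
proof -
  have RP: "radon_prob P"
    using P by (simp add: is_radon_product_def)
  interpret M: prob_space M
    using M by (rule radon_prob_prob_space)
  interpret N: prob_space N
    using N by (rule radon_prob_prob_space)
  interpret P: prob_space P
    using RP by (rule radon_prob_prob_space)
  have rect: "D x \<times> C x \<in> sets borel" if "x \<in> F" for x
  proof -
    have "D x \<times> C x = fst -` D x \<inter> snd -` C x"
      by auto
    then show ?thesis
      using D[OF that] C[OF that]
      by (auto intro!: sets.Int borel_vimage_continuous continuous_intros)
  qed
  then show "(\<Union>x\<in>F. D x \<times> C x) \<in> sets borel"
    using F by (intro sets.finite_UN) auto
  have "measure P (\<Union>x\<in>F. D x \<times> C x) = (\<Sum>x\<in>F. measure P (D x \<times> C x))"
    using F rect radon_prob_sets[OF RP]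
    by (intro P.finite_measure_finite_Union) (auto simp: disjoint_family_on_def)
  also have "\<dots> = (\<Sum>x\<in>F. measure M (D x) * measure N (C x))"
    using P C D by (intro sum.cong) (auto simp: is_radon_product_def measure_def enn2real_mult)
  finally show "measure P (\<Union>x\<in>F. D x \<times> C x) = (\<Sum>x\<in>F. measure M (D x) * measure N (C x))" .
qed

lemma section_eq_vimage: "Z `` {x} = (\<lambda>y. (x, y)) -` Z"
  by auto

lemma closed_section: "closed Z \<Longrightarrow> closed (Z `` {x})"
  unfolding section_eq_vimage by (intro closed_vimage continuous_intros)

text \<open>
  Upper semicontinuity of the sections of a closed set.
\<close>

lemma open_sections_within:
  fixes Z :: "('a::t2_space \<times> 'b::t2_space) set"
  assumes "compact (UNIV :: 'b set)" "closed Z" "open V"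
  shows "open {x. Z `` {x} \<subseteq> V}"
proof -
  have "open (- Z \<union> snd -` V)"
    using assms by (intro open_Un open_vimage continuous_intros) auto
  from open_tube[OF assms(1) this] have "open {x. \<forall>y. (x, y) \<in> - Z \<union> snd -` V}"
    by simp
  also have "{x. \<forall>y. (x, y) \<in> - Z \<union> snd -` V} = {x. Z `` {x} \<subseteq> V}"
    by auto
  finally show ?thesis .
qed

lemma closed_large_sections:
  fixes Z :: "('a::t2_space \<times> 'b::t2_space) set"
  assumes cpt: "compact (UNIV :: 'b set)" and N: "radon_prob N" and Z: "closed Z"
  shows "closed {x. t \<le> measure N (Z `` {x})}"
proof -
  interpret N: prob_space N
    using N by (rule radon_prob_prob_space)
  have "open {x. measure N (Z `` {x}) < t}"
  proof (subst open_subopen, clarify)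
    fix x assume "measure N (Z `` {x}) < t"
    then obtain V where V: "open V" "Z `` {x} \<subseteq> V" "measure N V < t"
      by (rule radon_prob_outer[OF N borel_closed[OF closed_section[OF Z]]])
    have "measure N (Z `` {x'}) < t" if "Z `` {x'} \<subseteq> V" for x'
    proof -
      have "measure N (Z `` {x'}) \<le> measure N V"
        using V(1) radon_prob_sets[OF N] that by (intro N.finite_measure_mono) auto
      then show ?thesis
        using V(3) by simp
    qed
    then show "\<exists>T. open T \<and> x \<in> T \<and> T \<subseteq> {x. measure N (Z `` {x}) < t}"
      using V open_sections_within[OF cpt Z V(1)]
      by (intro exI[of _ "{x. Z `` {x} \<subseteq> V}"]) auto
  qed
  moreover have "- {x. t \<le> measure N (Z `` {x})} = {x. measure N (Z `` {x}) < t}"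
    by auto
  ultimately show ?thesis
    by (simp add: closed_def)
qed

text \<open>
  Markov's inequality for the section measure.  Every open \<open>W\<close> that contains \<open>Z\<close> contains
  a finite union of disjoint rectangles \<open>D x \<times> Z `` {x}\<close> whose bases cover the points with a
  section of measure at least \<open>t\<close>, and those rectangles have height at least \<open>t\<close>.
\<close>

lemma radon_product_ge:
  fixes M :: "'a::t2_space measure" and N :: "'b::t2_space measure"
  assumes cptX: "compact (UNIV :: 'a set)" and cptY: "compact (UNIV :: 'b set)"
    and M: "radon_prob M" and N: "radon_prob N" and P: "is_radon_product M N P"
    and Z: "closed Z" and t: "t \<ge> 0"
  shows "t * measure M {x. t \<le> measure N (Z `` {x})} \<le> measure P Z"
proof (rule field_le_epsilon)
  have RP: "radon_prob P"
    using P by (simp add: is_radon_product_def)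
  interpret M: prob_space M
    using M by (rule radon_prob_prob_space)
  interpret P: prob_space P
    using RP by (rule radon_prob_prob_space)
  fix e :: real assume "e > 0"
  then have "measure P Z < measure P Z + e"
    by simp
  then obtain W where W: "open W" "Z \<subseteq> W" "measure P W < measure P Z + e"
    by (rule radon_prob_outer[OF RP borel_closed[OF Z]])
  define G where "G = {x. t \<le> measure N (Z `` {x})}"
  have "closed G"
    unfolding G_def using cptY N Z by (rule closed_large_sections)
  then have G: "compact G"
    using compact_Int_closed[OF cptX] by simp
  have sec: "compact (Z `` {x})" for x
    using compact_Int_closed[OF cptY closed_section[OF Z]] by simp
  define U where "U x = {x'. \<forall>y\<in>Z `` {x}. (x', y) \<in> W}" for x
  have "open (U x)" "x \<in> U x" for x
    using open_tube[OF sec W(1)] W(2) by (auto simp: U_def)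
  then obtain F D where FD: "finite F" "F \<subseteq> G" "disjoint_family_on D F"
      "\<And>x. x \<in> F \<Longrightarrow> D x \<in> sets borel" "\<And>x. x \<in> F \<Longrightarrow> D x \<subseteq> U x" "(\<Union>x\<in>F. D x) = G"
    using compact_disjoint_partition[OF G, of U] by metis
  have "t * measure M G = (\<Sum>x\<in>F. t * measure M (D x))"
    unfolding FD(6)[symmetric] sum_distrib_left[symmetric]
    using FD radon_prob_sets[OF M] by (subst M.finite_measure_finite_Union) auto
  also have "\<dots> \<le> (\<Sum>x\<in>F. measure M (D x) * measure N (Z `` {x}))"
    using FD(2) by (intro sum_mono, subst mult.commute) (auto simp: G_def intro!: mult_left_mono)
  also have "\<dots> = measure P (\<Union>x\<in>F. D x \<times> Z `` {x})"
    using FD Z by (intro is_radon_product_finite_Union(2)[OF M N P, symmetric])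
      (auto intro!: borel_closed closed_section)
  also have "\<dots> \<le> measure P W"
    using FD(5) W(1) radon_prob_sets[OF RP]
    by (intro P.finite_measure_mono) (auto simp: U_def subset_eq)
  finally show "t * measure M G \<le> measure P Z + e"
    using W(3) by simp
qed

text \<open>
  An open set \<open>O'\<close> is taken that barely exceeds the set of points with a large section.  The part
  of \<open>Z\<close> over \<open>O'\<close> has at most the measure of \<open>O'\<close>.  The rest lies in a finite union of disjoint rectangles
  \<open>D x \<times> V x\<close> of height less than \<open>t\<close>, with total measure at most \<open>t\<close>.
\<close>

lemma radon_product_le:
  fixes M :: "'a::t2_space measure" and N :: "'b::t2_space measure"
  assumes cptX: "compact (UNIV :: 'a set)" and cptY: "compact (UNIV :: 'b set)"
    and M: "radon_prob M" and N: "radon_prob N" and P: "is_radon_product M N P"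
    and Z: "closed Z" and t: "t \<ge> 0"
  shows "measure P Z \<le> measure M {x. t \<le> measure N (Z `` {x})} + t"
proof (rule field_le_epsilon)
  have RP: "radon_prob P"
    using P by (simp add: is_radon_product_def)
  interpret M: prob_space M
    using M by (rule radon_prob_prob_space)
  interpret N: prob_space N
    using N by (rule radon_prob_prob_space)
  interpret P: prob_space P
    using RP by (rule radon_prob_prob_space)
  fix e :: real assume "e > 0"
  define G where "G = {x. t \<le> measure N (Z `` {x})}"
  have "closed G"
    unfolding G_def using cptY N Z by (rule closed_large_sections)
  moreover have "measure M G < measure M G + e"
    using \<open>e > 0\<close> by simp
  ultimately obtain O' where O': "open O'" "G \<subseteq> O'" "measure M O' < measure M G + e"
    using radon_prob_outer[OF M borel_closed] by metis
  have K: "compact (- O')"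
    using compact_Int_closed[OF cptX, of "- O'"] O'(1) by (simp add: closed_def)
  have "\<exists>V. open V \<and> Z `` {x} \<subseteq> V \<and> measure N V < t" if "x \<in> - O'" for x
  proof -
    have "measure N (Z `` {x}) < t"
      using that O'(2) by (force simp: G_def)
    then obtain V where "open V" "Z `` {x} \<subseteq> V" "measure N V < t"
      by (rule radon_prob_outer[OF N borel_closed[OF closed_section[OF Z]]])
    then show ?thesis
      by metis
  qed
  then obtain V where V: "\<And>x. x \<in> - O' \<Longrightarrow> open (V x)" "\<And>x. x \<in> - O' \<Longrightarrow> Z `` {x} \<subseteq> V x"
      "\<And>x. x \<in> - O' \<Longrightarrow> measure N (V x) < t"
    by metis
  define U where "U x = {x'. Z `` {x'} \<subseteq> V x}" for x
  have "open (U x)" "x \<in> U x" if "x \<in> - O'" for x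
    using open_sections_within[OF cptY Z V(1)[OF that]] V(2)[OF that] by (auto simp: U_def)
  then obtain F D where FD: "finite F" "F \<subseteq> - O'" "disjoint_family_on D F"
      "\<And>x. x \<in> F \<Longrightarrow> D x \<in> sets borel" "\<And>x. x \<in> F \<Longrightarrow> D x \<subseteq> U x" "(\<Union>x\<in>F. D x) = - O'"
    using compact_disjoint_partition[OF K, of U] by metis
  define R where "R = (\<Union>x\<in>F. D x \<times> V x)"
  have R: "R \<in> sets borel" "measure P R = (\<Sum>x\<in>F. measure M (D x) * measure N (V x))"
    unfolding R_def using FD V(1)
    by (intro is_radon_product_finite_Union[OF M N P]; auto)+
  have OU: "O' \<times> UNIV \<in> sets borel"
    using O'(1) by (intro borel_open open_Times) auto
  have "measure P (O' \<times> UNIV) = measure M O'"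
    using P O'(1) N.emeasure_space_1 radon_prob_space[OF N]
    by (simp add: is_radon_product_def measure_def)
  moreover have "measure P R \<le> t"
  proof -
    have "measure P R \<le> (\<Sum>x\<in>F. measure M (D x) * t)"
      unfolding R(2) using FD(2) V(3) by (intro sum_mono mult_left_mono) (auto intro: less_imp_le)
    also have "\<dots> = measure M (- O') * t"
      unfolding FD(6)[symmetric] sum_distrib_right[symmetric]
      using FD radon_prob_sets[OF M] by (subst M.finite_measure_finite_Union) auto
    also have "\<dots> \<le> t"
      using t by (simp add: mult_left_le_one_le)
    finally show ?thesis .
  qed
  moreover have "measure P Z \<le> measure P (O' \<times> UNIV \<union> R)"
  proof (intro P.finite_measure_mono subsetI)
    fix z assume z: "z \<in> Z"
    show "z \<in> O' \<times> UNIV \<union> R"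
    proof (cases "fst z \<in> O'")
      case False
      then obtain x where x: "x \<in> F" "fst z \<in> D x"
        using FD(6) by blast
      then have "snd z \<in> V x"
        using FD(5)[of x] z by (cases z) (auto simp: U_def)
      then show ?thesis
        using x by (auto simp: R_def mem_Times_iff)
    qed (simp add: mem_Times_iff)
  qed (use OU R radon_prob_sets[OF RP] in auto)
  moreover have "measure P (O' \<times> UNIV \<union> R) \<le> measure P (O' \<times> UNIV) + measure P R"
    using OU R radon_prob_sets[OF RP] by (intro measure_Un_le) auto
  ultimately show "measure P Z \<le> measure M G + t + e"
    using O'(3) by linarith
qed

lemma radon_product_positive_iff:
  fixes M :: "'a::t2_space measure" and N :: "'b::t2_space measure"
  assumes cptX: "compact (UNIV :: 'a set)" and cptY: "compact (UNIV :: 'b set)"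
    and M: "radon_prob M" and N: "radon_prob N" and P: "is_radon_product M N P"
    and Z: "closed Z"
  shows "measure P Z > 0 \<longleftrightarrow> (\<exists>t>0. measure M {x. t \<le> measure N (Z `` {x})} > 0)"
proof
  assume "measure P Z > 0"
  then have "measure M {x. measure P Z / 2 \<le> measure N (Z `` {x})} > 0"
    using radon_product_le[OF assms, of "measure P Z / 2"] by simp
  then show "\<exists>t>0. measure M {x. t \<le> measure N (Z `` {x})} > 0"
    using \<open>measure P Z > 0\<close> by (intro exI[of _ "measure P Z / 2"]) simp
next
  assume "\<exists>t>0. measure M {x. t \<le> measure N (Z `` {x})} > 0"
  then obtain t where t: "t > 0" "measure M {x. t \<le> measure N (Z `` {x})} > 0"
    by blast
  then have "0 < t * measure M {x. t \<le> measure N (Z `` {x})}"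
    by simp
  also have "\<dots> \<le> measure P Z"
    using radon_product_ge[OF assms, of t] t by simp
  finally show "measure P Z > 0" .
qed

section \<open>Subgroups of compact groups\<close>

text \<open>
  The two group operations of a brace share one measure, and only one of the operations can be the
  ambient \<open>+\<close>.  The following facts are needed for the other one, hence for a group given as
  a record.
\<close>

locale compact_haar_group = group G for G :: "'a::t2_space monoid" (structure) +
  fixes \<mu> :: "'a measure"
  assumes carrier_UNIV: "carrier G = UNIV"
    and compact_UNIV: "compact (UNIV :: 'a set)"
    and continuous_mult: "continuous_on UNIV (\<lambda>(a, b). a \<otimes> b)"
    and radon: "radon_prob \<mu>"
    and left_invariant: "A \<in> sets borel \<Longrightarrow> measure \<mu> ((\<lambda>x. a \<otimes> x) ` A) = measure \<mu> A"
begin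

lemma in_carrier[simp]: "x \<in> carrier G"
  by (simp add: carrier_UNIV)

lemma continuous_left_mult: "continuous_on UNIV (\<lambda>x. a \<otimes> x)"
proof -
  have "continuous_on UNIV (\<lambda>x. (a, x))"
    by (intro continuous_on_Pair continuous_on_const continuous_on_id)
  from continuous_on_compose2[OF continuous_mult this] show ?thesis
    by simp
qed

lemma continuous_right_mult: "continuous_on UNIV (\<lambda>x. x \<otimes> a)"
proof -
  have "continuous_on UNIV (\<lambda>x. (x, a))"
    by (intro continuous_on_Pair continuous_on_const continuous_on_id)
  from continuous_on_compose2[OF continuous_mult this] show ?thesis
    by simp
qed

lemma translate_eq_vimage: "(\<lambda>x. a \<otimes> x) ` A = (\<lambda>x. inv a \<otimes> x) -` A"
proof (intro equalityI subsetI)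
  fix y assume "y \<in> (\<lambda>x. inv a \<otimes> x) -` A"
  then show "y \<in> (\<lambda>x. a \<otimes> x) ` A"
    by (intro image_eqI[of _ _ "inv a \<otimes> y"]) (auto simp: m_assoc[symmetric])
qed (auto simp: m_assoc[symmetric])

lemma translate_borel: "A \<in> sets borel \<Longrightarrow> (\<lambda>x. a \<otimes> x) ` A \<in> sets borel"
  unfolding translate_eq_vimage by (intro borel_vimage_continuous continuous_left_mult)

lemma open_subgroup_if_nhds:
  assumes H: "subgroup H G" and V: "open V" "\<one> \<in> V" "V \<subseteq> H"
  shows "open H"
proof (subst open_subopen, clarify)
  fix h assume h: "h \<in> H"
  have "open ((\<lambda>x. inv h \<otimes> x) -` V)"
    using V(1) by (intro open_vimage continuous_left_mult)
  moreover have "h \<in> (\<lambda>x. inv h \<otimes> x) -` V"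
    using V(2) by simp
  moreover have "(\<lambda>x. inv h \<otimes> x) -` V \<subseteq> H"
    unfolding translate_eq_vimage[symmetric]
    using V(3) h subgroup.m_closed[OF H] by (auto simp: subset_eq)
  ultimately show "\<exists>T. open T \<and> h \<in> T \<and> T \<subseteq> H"
    by (intro exI conjI)
qed

text \<open>
  Steinhaus' argument.  If \<open>U\<close> is an open set around \<open>A\<close> of measure less than twice that of
  \<open>A\<close>, then \<open>A\<close> and \<open>a \<otimes> A\<close> cannot be disjoint when both lie in \<open>U\<close>, which is the case for
  all \<open>a\<close> near \<open>\<one>\<close>.  A common point exhibits \<open>a\<close> as a quotient of two elements of \<open>A\<close>.
  Only a closed subset of \<open>H\<close> is asked to have positive measure because this is applied to subgroups
  that are not known to be closed.
\<close>

theorem open_subgroup_if_positive_measure: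
  assumes H: "subgroup H G" and A: "closed A" "A \<subseteq> H" and pos: "measure \<mu> A > 0"
  shows "open H"
proof -
  interpret prob_space \<mu>
    using radon by (rule radon_prob_prob_space)
  note [simp] = radon_prob_sets[OF radon] radon_prob_space[OF radon]
  have A': "compact A" "A \<in> sets borel"
    using compact_Int_closed[OF compact_UNIV A(1)] A(1) by (simp_all add: borel_closed)
  have "measure \<mu> A < 2 * measure \<mu> A"
    using pos by simp
  then obtain U where U: "open U" "A \<subseteq> U" "measure \<mu> U < 2 * measure \<mu> A"
    by (rule radon_prob_outer[OF radon A'(2)])
  define V where "V = {a. \<forall>x\<in>A. a \<otimes> x \<in> U}"
  have "open ((\<lambda>(a, x). a \<otimes> x) -` U)"
    using U(1) continuous_mult by (rule open_vimage)
  then have "open V"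
    using open_tube[OF A'(1), of "(\<lambda>(a, x). a \<otimes> x) -` U"] by (simp add: V_def)
  moreover have "\<one> \<in> V"
    using U(2) by (auto simp: V_def)
  moreover have "V \<subseteq> H"
  proof
    fix a assume "a \<in> V"
    then have sub: "A \<union> (\<lambda>x. a \<otimes> x) ` A \<subseteq> U"
      using U(2) by (auto simp: V_def)
    have "A \<inter> (\<lambda>x. a \<otimes> x) ` A \<noteq> {}"
    proof
      assume "A \<inter> (\<lambda>x. a \<otimes> x) ` A = {}"
      then have "measure \<mu> (A \<union> (\<lambda>x. a \<otimes> x) ` A) = 2 * measure \<mu> A"
        using A'(2) by (subst finite_measure_Union) (auto simp: left_invariant translate_borel)
      moreover have "measure \<mu> (A \<union> (\<lambda>x. a \<otimes> x) ` A) \<le> measure \<mu> U"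
        using sub U(1) by (intro finite_measure_mono) auto
      ultimately show False
        using U(3) by simp
    qed
    then obtain x where x: "x \<in> A" "a \<otimes> x \<in> A"
      by blast
    then have "(a \<otimes> x) \<otimes> inv x \<in> H"
      using A(2) H by (meson subgroup.m_closed subgroup.m_inv_closed subsetD)
    then show "a \<in> H"
      by (simp add: m_assoc)
  qed
  ultimately show ?thesis
    using open_subgroup_if_nhds[OF H] by blast
qed

text \<open>
  The cosets are a disjoint open cover of a compact space, so no coset can be omitted from a cover.
\<close>

lemma finite_index_if_open:
  assumes H: "subgroup H G" and op: "open H"
  shows "finite (rcosets H)"
proof -
  have coset: "H #> a = (\<lambda>x. x \<otimes> inv a) -` H" for a
  proof (intro equalityI subsetI)
    fix y assume "y \<in> (\<lambda>x. x \<otimes> inv a) -` H"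
    then show "y \<in> H #> a"
      unfolding r_coset_def by (auto simp: m_assoc intro!: bexI[of _ "y \<otimes> inv a"])
  qed (auto simp: r_coset_def m_assoc)
  have "open C" if "C \<in> rcosets H" for C
    using that op by (auto simp: RCOSETS_def coset intro!: open_vimage continuous_right_mult)
  moreover have cover: "UNIV \<subseteq> \<Union>(rcosets H)"
    using rcosets_part_G[OF H] by (simp add: carrier_UNIV)
  ultimately obtain \<C> where C: "\<C> \<subseteq> rcosets H" "finite \<C>" "UNIV \<subseteq> \<Union>\<C>"
    using compactE[OF compact_UNIV, of "rcosets H"] by metis
  have "rcosets H \<subseteq> \<C>"
  proof
    fix R assume R: "R \<in> rcosets H"
    then obtain a where a: "a \<in> R"
      using rcos_self[OF _ H] by (auto simp: RCOSETS_def)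
    then obtain S where S: "S \<in> \<C>" "a \<in> S"
      using C(3) by blast
    have "R = S"
      using rcos_disjoint[OF H] R S a C(1) by (auto simp: pairwise_def disjnt_def)
    then show "R \<in> \<C>"
      using S by simp
  qed
  then show ?thesis
    using C(2) finite_subset by blast
qed

text \<open>
  Right cosets are exchanged with left ones by inversion; left cosets are the ones that the left
  invariance of \<open>\<mu>\<close> can measure.
\<close>

lemma finite_translates_cover:
  assumes H: "subgroup H G" and fin: "finite (rcosets H)"
  obtains F where "finite F" "(\<Union>f\<in>F. (\<lambda>x. f \<otimes> x) ` H) = UNIV"
proof
  define s where "s C = (SOME a. a \<in> C)" for C :: "'a set"
  show "finite ((\<lambda>C. inv (s C)) ` (rcosets H))"
    using fin by simp
  have "g \<in> (\<Union>f\<in>(\<lambda>C. inv (s C)) ` (rcosets H). (\<lambda>x. f \<otimes> x) ` H)" for g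
  proof -
    define C where "C = H #> inv g"
    have "inv g \<in> C"
      unfolding C_def using H by (intro rcos_self) auto
    then have "s C \<in> C"
      unfolding s_def by (rule someI)
    then obtain h where h: "h \<in> H" "s C = h \<otimes> inv g"
      by (auto simp: C_def r_coset_def)
    then have "g = inv (s C) \<otimes> h"
      by (simp add: inv_mult_group m_assoc)
    moreover have "C \<in> rcosets H"
      by (auto simp: C_def RCOSETS_def)
    ultimately show ?thesis
      using h(1) by blast
  qed
  then show "(\<Union>f\<in>(\<lambda>C. inv (s C)) ` (rcosets H). (\<lambda>x. f \<otimes> x) ` H) = UNIV"
    by blast
qed

text \<open>
  Otherwise the whole group would be a countable union of null translates of the sets \<open>A m\<close>.
\<close>

lemma positive_measure_if_finite_index:
  assumes H: "subgroup H G" and fin: "finite (rcosets H)"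
    and cover: "H \<subseteq> (\<Union>m::nat. A m)" and A: "\<And>m. A m \<in> sets borel"
  obtains m where "measure \<mu> (A m) > 0"
proof (rule ccontr)
  interpret prob_space \<mu>
    using radon by (rule radon_prob_prob_space)
  note [simp] = radon_prob_sets[OF radon] radon_prob_space[OF radon]
  assume "\<not> thesis"
  then have zero: "measure \<mu> (A m) = 0" for m
    using that zero_less_measure_iff by blast
  obtain F where F: "finite F" "(\<Union>f\<in>F. (\<lambda>x. f \<otimes> x) ` H) = UNIV"
    using finite_translates_cover[OF H fin] .
  have null: "(\<lambda>x. f \<otimes> x) ` A m \<in> null_sets \<mu>" for f m
    using A by (intro null_setsI)
      (auto simp: emeasure_eq_measure left_invariant zero translate_borel)
  then have "(\<Union>m. (\<lambda>x. f \<otimes> x) ` A m) \<in> null_sets \<mu>" for f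
    by (rule null_sets_UN)
  then have "(\<Union>f\<in>F. \<Union>m. (\<lambda>x. f \<otimes> x) ` A m) \<in> null_sets \<mu>"
    by (rule null_sets_UN'[OF countable_finite[OF F(1)]])
  moreover have "(\<Union>f\<in>F. \<Union>m. (\<lambda>x. f \<otimes> x) ` A m) = UNIV"
    using F(2) cover by (auto simp: set_eq_iff) blast
  ultimately show False
    using emeasure_space_1 by auto
qed

end

section \<open>Brace centralizers as subgroups\<close>

context skew_left_brace
begin

lemma in_carrier[simp]: "x \<in> carrier B"
  by (simp add: carrier_UNIV)

text \<open>
  The lambda map of a skew brace.  It is an action of the multiplicative group by
  automorphisms of the additive group.
\<close>

definition lam :: "'a \<Rightarrow> 'a \<Rightarrow> 'a" where
  "lam a x = - a + a \<otimes> x"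

lemma mult_eq_add_lam: "a \<otimes> x = a + lam a x"
  by (simp add: lam_def add.assoc[symmetric])

lemma lam_add: "lam a (x + y) = lam a x + lam a y"
  by (simp add: lam_def brace_law add.assoc diff_conv_add_uminus del: add_uminus_conv_diff)

lemma lam_zero: "lam a 0 = 0"
  using lam_add[of a 0 0] add_left_cancel[of "lam a 0" "lam a 0" 0] by simp

lemma lam_uminus: "lam a (- x) = - lam a x"
  using lam_add[of a x "- x"] lam_zero by (metis add.right_inverse minus_unique)

lemma lam_mult: "lam (a \<otimes> b) x = lam a (lam b x)"
proof -
  have "a + lam a (b + lam b x) = (a \<otimes> b) + lam (a \<otimes> b) x"
    unfolding mult_eq_add_lam[symmetric] by (simp add: m_assoc)
  then have "a + lam a b + lam a (lam b x) = a + lam a b + lam (a \<otimes> b) x"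
    by (simp add: lam_add mult_eq_add_lam add.assoc)
  then show ?thesis
    by simp
qed

lemma lam_one: "lam \<one> x = x"
proof -
  have "lam \<one> x = - \<one> + x"
    by (simp add: lam_def)
  then show ?thesis
    by (simp add: one_eq_zero)
qed

lemma lam_inv_cancel [simp]: "lam (inv a) (lam a x) = x" "lam a (lam (inv a) x) = x"
  by (simp_all add: lam_mult[symmetric] lam_one)

lemma star_eq_zero_iff: "star B a b = 0 \<longleftrightarrow> lam a b = b"
  by (simp add: star_def lam_def)

lemma add_commutator_eq_zero_iff: "add_commutator a b = 0 \<longleftrightarrow> a + b = b + a"
  for a b :: 'a
  by (simp add: add_commutator_def diff_eq_eq)

lemma Cb_iff: "b \<in> Cb B x \<longleftrightarrow> lam x b = b \<and> lam b x = x \<and> x + b = b + x"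
  by (simp add: Cb_def star_eq_zero_iff add_commutator_eq_zero_iff)

text \<open>
  By this symmetry the single fact that every \<open>Cb B x\<close> is a subgroup also controls how \<open>Cb B x\<close>
  depends on \<open>x\<close>.
\<close>

lemma Cb_sym: "b \<in> Cb B x \<longleftrightarrow> x \<in> Cb B b"
  by (auto simp: Cb_iff)

lemma Cb_mult_comm: "b \<in> Cb B x \<Longrightarrow> x \<otimes> b = b \<otimes> x"
  by (simp add: Cb_iff mult_eq_add_lam)

text \<open>
  Membership of \<open>b\<close> means that \<open>lam x\<close> fixes \<open>b\<close>, that \<open>lam b\<close> fixes \<open>x\<close>, and that \<open>b\<close> and
  \<open>x\<close> commute additively; hence they also commute multiplicatively, and \<open>lam x\<close> commutes with
  \<open>lam b\<close>.  The product of \<open>b\<close> and \<open>c\<close> is \<open>b + lam b c\<close> and the inverse of \<open>b\<close> is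
  \<open>lam (inv b) (- b)\<close>, and both expressions inherit the three properties.
\<close>

lemma Cb_subgroup: "subgroup (Cb B x) B"
proof
  show "Cb B x \<subseteq> carrier B"
    by (simp add: carrier_UNIV)
  show "\<one> \<in> Cb B x"
    using lam_one[of x] by (simp add: Cb_iff one_eq_zero lam_zero)
next
  fix b c assume b: "b \<in> Cb B x" and c: "c \<in> Cb B x"
  have "lam x (lam b c) = lam b (lam x c)"
    unfolding lam_mult[symmetric] using Cb_mult_comm[OF b] by simp
  then have "lam x (lam b c) = lam b c"
    using c by (simp add: Cb_iff)
  then have "lam x (b \<otimes> c) = b \<otimes> c"
    using b by (simp add: mult_eq_add_lam lam_add Cb_iff)
  moreover have "lam (b \<otimes> c) x = x"
    using b c by (simp add: lam_mult Cb_iff)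
  moreover have "x + b \<otimes> c = b \<otimes> c + x"
  proof -
    have "lam b (x + c) = lam b (c + x)"
      using c by (simp add: Cb_iff)
    then have "x + lam b c = lam b c + x"
      using b by (simp add: lam_add Cb_iff)
    then show ?thesis
      using b unfolding mult_eq_add_lam Cb_iff by (metis add.assoc)
  qed
  ultimately show "b \<otimes> c \<in> Cb B x"
    by (simp add: Cb_iff)
next
  fix b assume b: "b \<in> Cb B x"
  have "b + lam b (inv b) = 0"
    by (simp add: mult_eq_add_lam[symmetric] one_eq_zero)
  then have "lam b (inv b) = - b"
    by (simp add: minus_unique)
  then have inv_b: "inv b = lam (inv b) (- b)"
    using lam_inv_cancel(1)[of b "inv b"] by simp
  have x: "lam (inv b) x = x"
    using b lam_inv_cancel(1)[of b x] by (simp add: Cb_iff)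
  have comm: "x \<otimes> inv b = inv b \<otimes> x"
  proof -
    have "inv b \<otimes> x = inv b \<otimes> (x \<otimes> b) \<otimes> inv b"
      by (simp add: m_assoc)
    also have "\<dots> = (inv b \<otimes> b) \<otimes> (x \<otimes> inv b)"
      unfolding Cb_mult_comm[OF b] by (simp only: m_assoc in_carrier inv_closed m_closed)
    finally show ?thesis
      by simp
  qed
  have "lam x (inv b) = lam x (lam (inv b) (- b))"
    using inv_b by simp
  also have "\<dots> = lam (inv b) (lam x (- b))"
    unfolding lam_mult[symmetric] using comm by simp
  also have "\<dots> = inv b"
    using b inv_b by (simp add: lam_uminus Cb_iff)
  finally have "lam x (inv b) = inv b" .
  moreover have "x + inv b = inv b + x"
  proof -
    have "x + - b = - b + x"
    proof -
      have "- b + (x + b) + - b = - b + (b + x) + - b"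
        using b by (simp add: Cb_iff)
      then show ?thesis
        by (simp add: add.assoc diff_conv_add_uminus del: add_uminus_conv_diff)
    qed
    then have "lam (inv b) (x + - b) = lam (inv b) (- b + x)"
      by simp
    then show ?thesis
      by (simp only: lam_add x inv_b[symmetric])
  qed
  ultimately show "inv b \<in> Cb B x"
    using x by (simp add: Cb_iff)
qed

lemma Cb_zero: "Cb B 0 = UNIV"
  using subgroup.one_closed[OF Cb_subgroup] Cb_sym by (auto simp: one_eq_zero)

lemma Cb_mult: "Cb B x \<inter> Cb B y \<subseteq> Cb B (x \<otimes> y)"
  using subgroup.m_closed[OF Cb_subgroup] Cb_sym by blast

lemma Cb_inv: "Cb B x \<subseteq> Cb B (inv x)"
  using subgroup.m_inv_closed[OF Cb_subgroup] Cb_sym by blast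

lemma commuting_pairs_section: "commuting_pairs B `` {x} = Cb B x"
  by (auto simp: commuting_pairs_def Cb_def)

end

section \<open>Compact skew braces\<close>

locale haar_skew_left_brace = compact_skew_left_brace B
  for B :: "'a::{topological_group_add, t2_space} monoid" (structure) +
  fixes \<mu> :: "'a measure"
  assumes haar: "haar_prob \<mu>"
begin

lemma continuous_lam: "continuous_on UNIV (lam a)"
proof -
  have "continuous_on UNIV (\<lambda>x. (a, x))"
    by (intro continuous_on_Pair continuous_on_const continuous_on_id)
  from continuous_on_compose2[OF continuous_mult this] show ?thesis
    unfolding lam_def by (intro continuous_intros) simp
qed

text \<open>
  The automorphism \<open>lam a\<close> transports Haar measure to Haar measure, so uniqueness applies.
\<close>

lemma haar_lam: "measure \<mu> (lam a -` A) = measure \<mu> A" if A: "A \<in> sets borel"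
proof -
  have R: "radon_prob \<mu>"
    using haar by (simp add: haar_prob_def)
  note [simp] = radon_prob_sets[OF R] radon_prob_space[OF R]
  have [measurable]: "lam a \<in> measurable \<mu> borel"
    using R continuous_lam by (rule radon_prob_measurable)
  have em: "emeasure (distr \<mu> borel (lam a)) X = emeasure \<mu> (lam a -` X)" if "X \<in> sets borel" for X
    using that by (simp add: emeasure_distr)
  have vim: "(\<lambda>x. b + x) -` X \<in> sets borel" if "X \<in> sets borel" for b and X :: "'a set"
    using that by (intro borel_vimage_continuous) (auto intro!: continuous_intros)
  have "haar_prob (distr \<mu> borel (lam a))"
    unfolding haar_prob_def
  proof (intro conjI allI ballI)
    show "radon_prob (distr \<mu> borel (lam a))"
      using R continuous_lam continuous_lam[of "inv a"]
      by (rule radon_prob_distr_homeomorphism) simp_all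
    fix b and X :: "'a set" assume X: "X \<in> sets borel"
    have "emeasure (distr \<mu> borel (lam a)) ((\<lambda>x. b + x) ` X) = emeasure \<mu> (lam a -` (\<lambda>x. - b + x) -` X)"
      using X vim[of X "- b"] add_vimage_eq_image[of "- b" X] by (simp add: em)
    also have "lam a -` (\<lambda>x. - b + x) -` X = (\<lambda>x. lam (inv a) (- b) + x) -` (lam a -` X)"
      by (auto simp: lam_add)
    also have "emeasure \<mu> \<dots> = emeasure \<mu> (lam a -` X)"
      using X by (intro haar_prob_vimage[OF haar] borel_vimage_continuous continuous_lam)
    finally show "emeasure (distr \<mu> borel (lam a)) ((\<lambda>x. b + x) ` X) = emeasure (distr \<mu> borel (lam a)) X"
      using X by (simp add: em)
  qed
  then have "distr \<mu> borel (lam a) = \<mu>"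
    using haar_prob_unique[OF compact_UNIV] haar by blast
  then show ?thesis
    using em[OF A] by (simp add: measure_def)
qed

text \<open>
  Multiplicative left translation by \<open>a\<close> is \<open>lam a\<close> followed by additive left translation by \<open>a\<close>,
  and \<open>\<mu>\<close> is invariant under both.
\<close>

sublocale compact_haar_group B \<mu>
proof unfold_locales
  show R: "radon_prob \<mu>"
    using haar by (simp add: haar_prob_def)
  fix a and A :: "'a set" assume A: "A \<in> sets borel"
  have img: "(\<lambda>x. a \<otimes> x) ` A = (\<lambda>x. a + x) ` (lam (inv a) -` A)"
  proof -
    have "lam a ` A = lam (inv a) -` A"
      by (auto intro!: image_eqI[of _ "lam a" "lam (inv a) _"])
    then show ?thesis
      by (simp add: mult_eq_add_lam image_image[symmetric])
  qed
  have "lam (inv a) -` A \<in> sets borel"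
    using A by (intro borel_vimage_continuous continuous_lam)
  then have "measure \<mu> ((\<lambda>x. a + x) ` (lam (inv a) -` A)) = measure \<mu> (lam (inv a) -` A)"
    using haar by (simp add: haar_prob_def measure_def)
  then show "measure \<mu> ((\<lambda>x. a \<otimes> x) ` A) = measure \<mu> A"
    using haar_lam[OF A] by (simp add: img)
qed (simp_all add: carrier_UNIV compact_UNIV continuous_mult)

lemma closed_commuting_pairs: "closed (commuting_pairs B)"
proof -
  have swap: "continuous_on UNIV (\<lambda>p::'a \<times> 'a. (snd p, fst p))"
    by (intro continuous_intros)
  have 1: "continuous_on UNIV (\<lambda>p. fst p \<otimes> snd p)"
    using continuous_mult by (simp add: case_prod_unfold)
  have 2: "continuous_on UNIV (\<lambda>p. snd p \<otimes> fst p)"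
    using continuous_on_compose2[OF continuous_mult swap] by simp
  have "commuting_pairs B = {p. star B (fst p) (snd p) = 0} \<inter> {p. star B (snd p) (fst p) = 0}
      \<inter> {p. add_commutator (fst p) (snd p) = 0}"
    by (auto simp: commuting_pairs_def)
  also have "closed \<dots>"
    unfolding star_def add_commutator_def
    by (intro closed_Int closed_Collect_eq continuous_intros 1 2)
  finally show ?thesis .
qed

lemma closed_Cb: "closed (Cb B x)"
  using closed_section[OF closed_commuting_pairs, of x] by (simp add: commuting_pairs_section)

lemma FCI_iff_positive_measure: "x \<in> FCI B \<longleftrightarrow> measure \<mu> (Cb B x) > 0"
proof
  assume "x \<in> FCI B"
  then show "measure \<mu> (Cb B x) > 0"
    using positive_measure_if_finite_index[OF Cb_subgroup, of x "\<lambda>_. Cb B x"] closed_Cb[of x]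
    by (auto simp: FCI_def)
next
  assume "measure \<mu> (Cb B x) > 0"
  then have "open (Cb B x)"
    using open_subgroup_if_positive_measure[OF Cb_subgroup closed_Cb order_refl] by simp
  then show "x \<in> FCI B"
    using finite_index_if_open[OF Cb_subgroup] by (simp add: FCI_def)
qed

lemma FCI_iff_open: "x \<in> FCI B \<longleftrightarrow> open (Cb B x)"
  using FCI_iff_positive_measure[of x] finite_index_if_open[OF Cb_subgroup, of x]
    open_subgroup_if_positive_measure[OF Cb_subgroup closed_Cb order_refl, of x]
  by (auto simp: FCI_def)

text \<open>
  Finite index of the centralizers is replaced by openness, which passes to intersections and to
  larger subgroups.
\<close>

lemma FCI_subgroup: "subgroup (FCI B) B"
proof
  show "\<one> \<in> FCI B"
    by (simp add: FCI_iff_open one_eq_zero Cb_zero)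
next
  fix x y assume "x \<in> FCI B" "y \<in> FCI B"
  then have "open (Cb B x \<inter> Cb B y)"
    by (simp add: FCI_iff_open open_Int)
  then have "open (Cb B (x \<otimes> y))"
    using subgroup.one_closed[OF Cb_subgroup] Cb_mult
    by (intro open_subgroup_if_nhds[OF Cb_subgroup, of "Cb B x \<inter> Cb B y"]) auto
  then show "x \<otimes> y \<in> FCI B"
    by (simp add: FCI_iff_open)
next
  fix x assume "x \<in> FCI B"
  then have "open (Cb B x)"
    by (simp add: FCI_iff_open)
  then have "open (Cb B (inv x))"
    using subgroup.one_closed[OF Cb_subgroup] Cb_inv by (rule open_subgroup_if_nhds[OF Cb_subgroup])
  then show "inv x \<in> FCI B"
    by (simp add: FCI_iff_open)
qed (simp add: carrier_UNIV)

text \<open>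
  For \<open>t\<close> tending to \<open>0\<close> these closed sets exhaust \<open>FCI B\<close>; they carry all the measure theory
  that concerns \<open>FCI B\<close>.
\<close>

definition thick :: "real \<Rightarrow> 'a set" where
  "thick t = {x. t \<le> measure \<mu> (Cb B x)}"

lemma closed_thick: "closed (thick t)"
  using closed_large_sections[OF compact_UNIV radon closed_commuting_pairs]
  by (simp add: thick_def commuting_pairs_section)

lemma thick_subset_FCI: "t > 0 \<Longrightarrow> thick t \<subseteq> FCI B"
  by (auto simp: thick_def FCI_iff_positive_measure)

lemma FCI_subset_Union_thick: "FCI B \<subseteq> (\<Union>m. thick (1 / real (Suc m)))"
proof
  fix x assume "x \<in> FCI B"
  then have "measure \<mu> (Cb B x) > 0"
    by (simp add: FCI_iff_positive_measure)
  then obtain m where "1 / real (Suc m) < measure \<mu> (Cb B x)"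
    by (rule nat_approx_posE)
  then show "x \<in> (\<Union>m. thick (1 / real (Suc m)))"
    by (auto simp: thick_def intro!: exI[of _ m])
qed

lemma open_FCI_if_thick:
  assumes "t > 0" "measure \<mu> (thick t) > 0"
  shows "open (FCI B)"
  using assms(2)
  by (rule open_subgroup_if_positive_measure[OF FCI_subgroup closed_thick thick_subset_FCI[OF assms(1)]])

lemma thick_if_finite_index:
  assumes "finite (rcosets (FCI B))"
  obtains t where "t > 0" "measure \<mu> (thick t) > 0"
proof -
  obtain m where "measure \<mu> (thick (1 / real (Suc m))) > 0"
    by (rule positive_measure_if_finite_index[OF FCI_subgroup assms FCI_subset_Union_thick
          borel_closed[OF closed_thick]])
  then show ?thesis
    by (intro that[of "1 / real (Suc m)"]) auto
qed

lemma Pb_pos_iff: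
  assumes "is_radon_product \<mu> \<mu> P"
  shows "Pb B P > 0 \<longleftrightarrow> (\<exists>t>0. measure \<mu> (thick t) > 0)"
  using radon_product_positive_iff[OF compact_UNIV compact_UNIV radon radon assms closed_commuting_pairs]
  by (simp add: Pb_def thick_def commuting_pairs_section)

end

theorem theorem5p9:
  fixes B :: "'a::{topological_group_add, t2_space} monoid"
    and \<mu> :: "'a measure"
    and \<mu>\<mu> :: "('a \<times> 'a) measure"
  assumes "compact_skew_left_brace B"
    and "haar_prob \<mu>"
    and "is_radon_product \<mu> \<mu> \<mu>\<mu>"
  shows "(Pb B \<mu>\<mu> > 0 \<longleftrightarrow> open (FCI B)) \<and>
         (open (FCI B) \<longleftrightarrow> finite (rcosets\<^bsub>B\<^esub> (FCI B)))"
proof -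
  interpret haar_skew_left_brace B \<mu>
    using assms(1,2) by (simp add: haar_skew_left_brace_def haar_skew_left_brace_axioms_def)
  have "open (FCI B)" if "Pb B \<mu>\<mu> > 0"
    using that Pb_pos_iff[OF assms(3)] open_FCI_if_thick by blast
  moreover have "finite (rcosets\<^bsub>B\<^esub> (FCI B))" if "open (FCI B)"
    using FCI_subgroup that by (rule finite_index_if_open)
  moreover have "Pb B \<mu>\<mu> > 0" if "finite (rcosets\<^bsub>B\<^esub> (FCI B))"
    using thick_if_finite_index[OF that] Pb_pos_iff[OF assms(3)] by metis
  ultimately show ?thesis
    by blast
qed

end
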